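(* Let $\mathbb{F}$ be a field and let $f\in\mathbb{F}[x_1,\ldots,x_n]$ be defined by $f(\overline{x})=\prod_{1\le i<j\le n}(x_i+x_j+\alpha_{i,j})$ for $\alpha_{i,j}\in\mathbb{F}$. Then for any partition $\overline{x}=(\overline{u},\overline{v},\overline{w})$ of the variables with $m=|\overline{u}|=|\overline{v}|$, and any $0\ne g\in\mathbb{F}[\overline{x}]$, $$\dim_{\mathbb{F}(\overline{w})}\mathbf{Coeff}_{\overline{u}|\overline{v}}(g\cdot f)\ge2^m,$$ where we treat $g\cdot f$ as a polynomial in $\mathbb{F}(\overline{w})[\overline{u},\overline{v}]$. In particular, all nonzero multiples of $f$ require width $\ge2^{\lfloor n/2\rfloor}$ to be computed by an roABP in any variable order.
   Context: For a field $\mathbb{K}$ and $h\in\mathbb{K}[\overline{u},\overline{v}]$, write $h=\sum_{\overline{b}}h_{\overline{b}}(\overline{u})\,\overline{v}^{\overline{b}}$ with $h_{\overline{b}}\in\mathbb{K}[\overline{u}]$; then $\mathbf{Coeff}_{\overline{u}|\overline{v}}(h)=\{h_{\overline{b}}\}_{\overline{b}}$ and $\dim_{\mathbb{K}}\mathbf{Coeff}_{\overline{u}|\overline{v}}(h)$ is the dimension of its $\mathbb{K}$-linear span. Here $\mathbb{K}=\mathbb{F}(\overline{w})$, the field of rational functions in $\overline{w}$. A width-$r$ read-once oblivious algebraic branching program (roABP) on $N$ variables in variable order $v_1<\cdots<v_N$ is a directed acyclic graph with vertex layers $V_0=\{s\},V_1,\ldots,V_N=\{t\}$, $|V_i|\le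 r$, edges only from $V_{i-1}$ to $V_i$, each edge from $V_{i-1}$ to $V_i$ labelled by a univariate polynomial in $v_i$; it computes the sum over all $s$–$t$ paths of the product of edge labels. *)

theory Defs
  imports
    "HOL-Library.Poly_Mapping"
    "HOL-Computational_Algebra.Fraction_Field"
    "HOL-Algebra.Algebraic_Closure_Type"
    "Graph_Theory.Arc_Walk"
begin

section \<open>Multivariate polynomials\<close>

text \<open>
  Polynomials in the variables $x_i$, $i$ a natural number: finitely supported functions from
  exponent vectors to coefficients. The ring $\mathbb{F}[x_1,\ldots,x_n]$ consists of those
  \<open>p\<close> with \<open>mvars p \<subseteq> {1..n}\<close>.
\<close>

type_synonym expvec = "nat \<Rightarrow>\<^sub>0 nat"
type_synonym 'a mpoly = "expvec \<Rightarrow>\<^sub>0 'a"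

definition Const :: "'a::zero \<Rightarrow> 'a mpoly" where
  "Const c = Poly_Mapping.single 0 c"

definition Var :: "nat \<Rightarrow> 'a::zero_neq_one mpoly" where
  "Var i = Poly_Mapping.single (Poly_Mapping.single i 1) 1"

definition mvars :: "'a::zero mpoly \<Rightarrow> nat set" where
  "mvars p = (\<Union>e\<in>Poly_Mapping.keys p. Poly_Mapping.keys e)"

definition restrict_exp :: "nat set \<Rightarrow> expvec \<Rightarrow> expvec" where
  "restrict_exp S e = Poly_Mapping.mapp (\<lambda>i k. if i \<in> S then k else 0) e"


section \<open>Rational functions in a subset of the variables\<close>

text \<open>
  Since \<open>W\<close> is a set and not a type, the field $\mathbb{F}(\overline{w})$ is realised as a subfield
  of the field of fractions of the polynomial ring in all variables.
\<close>

type_synonym 'a ratfun = "'a mpoly fract"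

definition ratfuns :: "nat set \<Rightarrow> 'a::field ratfun set" where
  "ratfuns W = {Fract p q | p q. q \<noteq> 0 \<and> mvars p \<subseteq> W \<and> mvars q \<subseteq> W}"

text \<open>
  A polynomial viewed as a polynomial in the variables outside \<open>W\<close> with coefficients
  in $\mathbb{F}(\overline{w})$: the monomial $x^e$ is split into its part outside \<open>W\<close>, which
  becomes the exponent vector, and its part in \<open>W\<close>, which is moved to the coefficient.
\<close>

definition over_ratfuns :: "nat set \<Rightarrow> 'a::field mpoly \<Rightarrow> 'a ratfun mpoly" where
  "over_ratfuns W p =
     (\<Sum>e\<in>Poly_Mapping.keys p.
        Poly_Mapping.single (restrict_exp (- W) e)
          (Fract (Poly_Mapping.single (restrict_exp W e) (Poly_Mapping.lookup p e)) 1))"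


section \<open>Coefficient dimension\<close>

text \<open>
  For \<open>h\<close> with \<open>mvars h \<subseteq> U \<union> V\<close> (\<open>U\<close>, \<open>V\<close> disjoint), \<open>coeff_at U V h b\<close> is the coefficient
  $h_{\overline{b}}(\overline{u})$ of $\overline{v}^{\overline{b}}$ in \<open>h\<close>.
\<close>

definition coeff_at :: "nat set \<Rightarrow> nat set \<Rightarrow> 'a::comm_monoid_add mpoly \<Rightarrow> expvec \<Rightarrow> 'a mpoly" where
  "coeff_at U V h b =
     (\<Sum>e | e \<in> Poly_Mapping.keys h \<and> restrict_exp V e = b.
        Poly_Mapping.single (restrict_exp U e) (Poly_Mapping.lookup h e))"

definition Coeffs :: "nat set \<Rightarrow> nat set \<Rightarrow> 'a::comm_monoid_add mpoly \<Rightarrow> 'a mpoly set" where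
  "Coeffs U V h = {coeff_at U V h b | b. Poly_Mapping.keys b \<subseteq> V}"

text \<open>
  The dimension over a subfield \<open>K\<close> of the \<open>K\<close>-linear span of a set of
  polynomials, by way of the theory of algebras over a subfield of a ring in HOL-Algebra; there
  \<open>K\<close> appears as the set of constant polynomials with value in \<open>K\<close>.
\<close>

definition poly_span :: "'a::field set \<Rightarrow> 'a mpoly set \<Rightarrow> 'a mpoly set" where
  "poly_span K S = (\<Union>us \<in> {us. set us \<subseteq> S}. ring.Span ring_of_type_algebra (Const ` K) us)"

definition poly_dim :: "'a::field set \<Rightarrow> 'a mpoly set \<Rightarrow> nat" where
  "poly_dim K S = ring.dim ring_of_type_algebra (Const ` K) (poly_span K S)"


section \<open>Well-definedness\<close>

text \<open>
  The constants with value in \<open>ratfuns W\<close> form a subfield of the polynomial ring, and the spans of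
  finite sets, such as \<open>Coeffs U V h\<close>, are finite-dimensional over it. So \<open>poly_dim\<close> is a true
  dimension, and \<open>coeff_at\<close> does give the expansion of a polynomial in $\overline{v}$.
\<close>

lemma mvars_add: "mvars p \<subseteq> W \<Longrightarrow> mvars q \<subseteq> W \<Longrightarrow> mvars (p + q) \<subseteq> W"
  using Poly_Mapping.keys_add[of p q] unfolding mvars_def by blast

lemma mvars_mult:
  fixes p q :: "'a::field mpoly"
  assumes "mvars p \<subseteq> W" "mvars q \<subseteq> W" shows "mvars (p * q) \<subseteq> W"
proof -
  have "Poly_Mapping.keys e \<subseteq> W" if ein: "e \<in> Poly_Mapping.keys (p * q)" for e
  proof -
    obtain a b where ab: "a \<in> Poly_Mapping.keys p" "b \<in> Poly_Mapping.keys q" "e = a + b"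
      using Poly_Mapping.keys_mult[of p q] ein by blast
    then show ?thesis using assms Poly_Mapping.keys_add[of a b] unfolding mvars_def by blast
  qed
  then show ?thesis unfolding mvars_def by blast
qed

lemma mvars_uminus: "mvars (- p) = mvars (p :: 'a::field mpoly)"
  by (auto simp: mvars_def in_keys_iff)

lemma ratfunsI: "q \<noteq> 0 \<Longrightarrow> mvars p \<subseteq> W \<Longrightarrow> mvars q \<subseteq> W \<Longrightarrow> Fract p q \<in> ratfuns W"
  unfolding ratfuns_def by blast

lemma ratfuns_one: "1 \<in> ratfuns W"
  unfolding One_fract_def by (rule ratfunsI) (auto simp: mvars_def)

lemma ratfuns_closed:
  assumes "x \<in> ratfuns W" "y \<in> ratfuns W"
  shows "x + y \<in> ratfuns W" "x * y \<in> ratfuns W" "- x \<in> ratfuns W" "inverse x \<in> ratfuns W"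
proof -
  obtain a b where x: "x = Fract a b" "b \<noteq> 0" "mvars a \<subseteq> W" "mvars b \<subseteq> W"
    using assms(1) unfolding ratfuns_def by blast
  obtain c d where y: "y = Fract c d" "d \<noteq> 0" "mvars c \<subseteq> W" "mvars d \<subseteq> W"
    using assms(2) unfolding ratfuns_def by blast
  show "x + y \<in> ratfuns W" using x y by (simp add: ratfunsI mvars_add mvars_mult)
  show "x * y \<in> ratfuns W" using x y by (simp add: ratfunsI mvars_add mvars_mult)
  show "- x \<in> ratfuns W" using x by (simp add: ratfunsI mvars_uminus)
  show "inverse x \<in> ratfuns W"
  proof (cases "a = 0")
    case True
    then have "inverse x = Fract 0 1" using x by (simp add: eq_fract)
    then show ?thesis by (simp add: ratfunsI mvars_def)
  next
    case False
    then show ?thesis using x by (simp add: ratfunsI)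
  qed
qed

lemma subfield_Const_ratfuns:
  "subfield (Const ` ratfuns W) (ring_of_type_algebra :: 'a::field ratfun mpoly ring)" (is "subfield ?K ?R")
proof -
  interpret cring ?R by (rule cring_from_type_algebra)
  have R: "carrier ?R = UNIV" "\<And>x y. x \<otimes>\<^bsub>?R\<^esub> y = x * y" "\<And>x y. x \<oplus>\<^bsub>?R\<^esub> y = x + y"
    "\<zero>\<^bsub>?R\<^esub> = 0" "\<one>\<^bsub>?R\<^esub> = 1"
    by (auto simp: ring_of_type_algebra_def)
  have m: "\<ominus>\<^bsub>?R\<^esub> x = - x" for x
    using sum_zero_eq_neg[of "-x" x] by (simp add: R)
  have C: "Const a + Const b = Const (a + b)" "Const a * Const b = Const (a * b)"
    "- Const a = Const (- a)" for a b :: "'a ratfun"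
    by (simp_all add: Const_def single_add mult_single single_uminus)
  have one: "Const 1 = (1 :: 'a ratfun mpoly)" by (simp add: Const_def)
  show ?thesis
  proof (rule subfieldI)
    show "subcring ?K ?R"
    proof (rule subcringI)
      show "subring ?K ?R"
      proof (rule subringI)
        show "\<one>\<^bsub>?R\<^esub> \<in> ?K"
          unfolding R(5) one[symmetric] by (rule imageI) (rule ratfuns_one)
      next
        fix x y assume "x \<in> ?K" "y \<in> ?K"
        then obtain a b where ab: "x = Const a" "a \<in> ratfuns W" "y = Const b" "b \<in> ratfuns W"
          by blast
        show "\<ominus>\<^bsub>?R\<^esub> x \<in> ?K" "x \<otimes>\<^bsub>?R\<^esub> y \<in> ?K" "x \<oplus>\<^bsub>?R\<^esub> y \<in> ?K"
          unfolding m R C ab using ab by (blast intro: ratfuns_closed)+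
      qed (simp add: R)
      show "x \<otimes>\<^bsub>?R\<^esub> y = y \<otimes>\<^bsub>?R\<^esub> x" for x y
        by (simp only: R mult.commute)
    qed
    show "Units (?R\<lparr>carrier := ?K\<rparr>) = ?K - {\<zero>\<^bsub>?R\<^esub>}"
    proof (intro equalityI subsetI)
      fix x assume "x \<in> Units (?R\<lparr>carrier := ?K\<rparr>)"
      then obtain y where "x \<in> ?K" "y * x = 1"
        by (auto simp: Units_def R)
      then show "x \<in> ?K - {\<zero>\<^bsub>?R\<^esub>}" by (auto simp: R)
    next
      fix x assume "x \<in> ?K - {\<zero>\<^bsub>?R\<^esub>}"
      then obtain a where a: "x = Const a" "a \<in> ratfuns W" and "x \<noteq> 0"
        by (auto simp: R)
      then have "a \<noteq> 0"
        by (auto simp: Const_def)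
      have "Const (inverse a) * x = 1" "x * Const (inverse a) = 1"
        using a \<open>a \<noteq> 0\<close> by (simp_all add: C one)
      moreover have "x \<in> ?K" "Const (inverse a) \<in> ?K"
        using a by (blast intro: ratfuns_closed)+
      ultimately have "x \<in> {x \<in> ?K. \<exists>y\<in>?K. y * x = 1 \<and> x * y = 1}"
        by blast
      also have "\<dots> = Units (?R\<lparr>carrier := ?K\<rparr>)"
        by (simp add: Units_def R)
      finally show "x \<in> Units (?R\<lparr>carrier := ?K\<rparr>)" .
    qed
  qed
qed

lemma finite_Coeffs: "finite (Coeffs U V h)"
proof -
  have "Coeffs U V h \<subseteq> insert 0 (coeff_at U V h ` (restrict_exp V ` Poly_Mapping.keys h))"
  proof
    fix c assume "c \<in> Coeffs U V h"
    then obtain b where b: "c = coeff_at U V h b" unfolding Coeffs_def by blast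
    show "c \<in> insert 0 (coeff_at U V h ` (restrict_exp V ` Poly_Mapping.keys h))"
    proof (cases "b \<in> restrict_exp V ` Poly_Mapping.keys h")
      case False
      then have "{e. e \<in> Poly_Mapping.keys h \<and> restrict_exp V e = b} = {}" by auto
      then have "c = 0" unfolding b coeff_at_def by (simp only: sum.empty)
      then show ?thesis by simp
    qed (use b in auto)
  qed
  then show ?thesis by (rule finite_subset) auto
qed

lemma poly_span_finite_dim:
  fixes S :: "'a::field ratfun mpoly set"
  assumes "finite S"
  shows "ring.finite_dimension ring_of_type_algebra (Const ` ratfuns W) (poly_span (ratfuns W) S)"
proof -
  let ?R = "ring_of_type_algebra :: 'a ratfun mpoly ring"
  let ?K = "Const ` ratfuns W :: 'a ratfun mpoly set"
  interpret ring ?R by (rule ring_from_type_algebra)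
  have car: "carrier ?R = UNIV" by (simp add: ring_of_type_algebra_def)
  obtain us where us: "set us = S" using finite_list[OF assms] by blast
  have "Span ?K vs \<subseteq> Span ?K us" if "set vs \<subseteq> set us" for vs
    using mono_Span_sublist[OF subfield_Const_ratfuns that] by (simp add: car del: Span.simps)
  then have "poly_span (ratfuns W) S = Span ?K us"
    unfolding poly_span_def us[symmetric] by blast
  then show ?thesis
    using Span_finite_dimension[OF subfield_Const_ratfuns[of W], of us] by (simp add: car del: Span.simps)
qed

lemma coeff_at_expansion:
  assumes "mvars h \<subseteq> U \<union> V" "U \<inter> V = {}"
  shows "h = (\<Sum>b\<in>restrict_exp V ` Poly_Mapping.keys h.
                coeff_at U V h b * Poly_Mapping.single b (1::'a::field))"
proof -
  have split: "restrict_exp U e + restrict_exp V e = e" if "e \<in> Poly_Mapping.keys h" for e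
  proof (rule poly_mapping_eqI)
    fix i
    have "Poly_Mapping.keys e \<subseteq> U \<union> V" using that assms(1) unfolding mvars_def by blast
    then show "Poly_Mapping.lookup (restrict_exp U e + restrict_exp V e) i = Poly_Mapping.lookup e i"
      using assms(2) by (auto simp: restrict_exp_def lookup_add mapp.rep_eq in_keys_iff)
  qed
  have mon: "h = (\<Sum>e\<in>Poly_Mapping.keys h. Poly_Mapping.single e (Poly_Mapping.lookup h e))"
    by (rule poly_mapping_eqI) (auto simp: lookup_sum lookup_single when_def in_keys_iff)
  have "(\<Sum>b\<in>restrict_exp V ` Poly_Mapping.keys h. coeff_at U V h b * Poly_Mapping.single b 1)
      = (\<Sum>b\<in>restrict_exp V ` Poly_Mapping.keys h.
           \<Sum>e | e \<in> Poly_Mapping.keys h \<and> restrict_exp V e = b.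
             Poly_Mapping.single e (Poly_Mapping.lookup h e))"
    unfolding coeff_at_def sum_distrib_right
    by (intro sum.cong refl) (auto simp: mult_single split)
  also have "\<dots> = (\<Sum>e\<in>Poly_Mapping.keys h. Poly_Mapping.single e (Poly_Mapping.lookup h e))"
    by (rule sum.image_gen[symmetric]) simp
  finally show ?thesis using mon by simp
qed


section \<open>Read-once oblivious algebraic branching programs\<close>

record (overloaded) ('v, 'e, 'a) abp =
  graph :: "('v, 'e) pre_digraph"
  layer :: "nat \<Rightarrow> 'v set"
  source :: 'v
  sink :: 'v
  label :: "'e \<Rightarrow> 'a mpoly"

text \<open>
  The variable order is the list \<open>vs\<close>, so that $v_i$ is \<open>vs ! (i - 1)\<close>. Parallel arcs are allowed.
  Acyclicity is a consequence of the layering.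
\<close>

definition is_roabp :: "nat list \<Rightarrow> nat \<Rightarrow> ('v, 'e, 'a::field) abp \<Rightarrow> bool" where
  "is_roabp vs r A \<longleftrightarrow>
     distinct vs \<and>
     fin_digraph (graph A) \<and>
     verts (graph A) = (\<Union>i\<le>length vs. layer A i) \<and>
     (\<forall>i\<le>length vs. \<forall>j\<le>length vs. i \<noteq> j \<longrightarrow> layer A i \<inter> layer A j = {}) \<and>
     layer A 0 = {source A} \<and>
     layer A (length vs) = {sink A} \<and>
     (\<forall>i\<le>length vs. card (layer A i) \<le> r) \<and>
     (\<forall>e\<in>arcs (graph A). \<exists>i\<in>{1..length vs}.
        tail (graph A) e \<in> layer A (i - 1) \<and> head (graph A) e \<in> layer A i \<and>
        mvars (label A e) \<subseteq> {vs ! (i - 1)})"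

definition abp_poly :: "('v, 'e, 'a::field) abp \<Rightarrow> 'a mpoly" where
  "abp_poly A =
     (\<Sum>p | pre_digraph.apath (graph A) (source A) p (sink A). prod_list (map (label A) p))"

end

theory Submission
  imports Defs
begin

text \<open>
  Pair every variable \<open>u\<close> of \<open>U\<close> with a variable \<open>v\<close> outside \<open>U\<close>; then \<open>g * f\<close> is a nonzero multiple of
  the product of the linear forms \<open>u + v + c\<close> over the pairs. Going through the pairs one at a time,
  the part of top degree in \<open>u\<close>, \<open>v\<close> contributes two distinct extreme bidegrees, and the two slices of
  these bidegrees are again nonzero multiples of the remaining product. Since no monomial exceeds
  the top degree, the coefficient matrix is block triangular with respect to them, so \<open>m\<close> pairs
  yield a triangular minor of size \<open>2^m\<close>. It makes \<open>2^m\<close> of the coefficients in \<open>v\<close> linearly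
  independent over the rational functions in \<open>w\<close>. A roABP factors its polynomial through each of its
  layers, so the width is at least the rank of the coefficient matrix at the middle layer.
\<close>

section \<open>Exponents and slices\<close>

text \<open>In the coefficient matrix with rows indexed by \<open>U\<close>-parts and columns by
  \<open>V\<close>-parts, \<open>agree U\<close> means same row and \<open>agree V\<close> means
  same column. The pointwise form lets agreement on \<open>insert u U\<close> unfold into a
  condition at \<open>u\<close> and one on \<open>U\<close>.\<close>

definition agree :: "nat set \<Rightarrow> expvec \<Rightarrow> expvec \<Rightarrow> bool" where
  "agree S d e \<longleftrightarrow> (\<forall>x\<in>S. Poly_Mapping.lookup d x = Poly_Mapping.lookup e x)"

lemma lookup_restrict_exp:
  "Poly_Mapping.lookup (restrict_exp S e) x = (if x \<in> S then Poly_Mapping.lookup e x else 0)"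
  by (auto simp: restrict_exp_def lookup_mapp in_keys_iff when_def)

lemma restrict_exp_eq_iff: "restrict_exp S d = restrict_exp S e \<longleftrightarrow> agree S d e"
proof
  assume "restrict_exp S d = restrict_exp S e"
  then have "Poly_Mapping.lookup (restrict_exp S d) x = Poly_Mapping.lookup (restrict_exp S e) x" for x
    by simp
  then show "agree S d e"
    unfolding agree_def lookup_restrict_exp by (metis (full_types))
qed (auto simp: agree_def lookup_restrict_exp intro!: poly_mapping_eqI)

text \<open>A slice stays in the same polynomial ring, so it can serve directly as a new multiplier
  in the induction on the pairs.\<close>

definition slice :: "(expvec \<Rightarrow> bool) \<Rightarrow> 'a::zero mpoly \<Rightarrow> 'a mpoly" where
  "slice Q p = Poly_Mapping.mapp (\<lambda>e c. if Q e then c else 0) p"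

lemma lookup_slice:
  "Poly_Mapping.lookup (slice Q p) e = (if Q e then Poly_Mapping.lookup p e else 0)"
  by (auto simp: slice_def lookup_mapp in_keys_iff when_def)

lemma keys_slice: "Poly_Mapping.keys (slice Q p) = {e \<in> Poly_Mapping.keys p. Q e}"
  by (auto simp: in_keys_iff lookup_slice split: if_splits)

lemma slice_add: "slice Q (p + q) = slice Q p + slice Q q"
  by (rule poly_mapping_eqI) (simp add: lookup_slice lookup_add)

lemma slice_eq_self: "(\<And>e. e \<in> Poly_Mapping.keys p \<Longrightarrow> Q e) \<Longrightarrow> slice Q p = p"
  by (rule poly_mapping_eqI) (auto simp: lookup_slice in_keys_iff)

lemma slice_eq_0: "(\<And>e. e \<in> Poly_Mapping.keys p \<Longrightarrow> \<not> Q e) \<Longrightarrow> slice Q p = 0"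
  by (rule poly_mapping_eqI) (auto simp: lookup_slice in_keys_iff)

text \<open>Split \<open>p\<close> by \<open>Q'\<close>: every monomial of the first part times
  \<open>q\<close> satisfies \<open>Q\<close>, and none of the second part times \<open>q\<close>
  does. This moves a slice past a factor that shifts the sliced exponents uniformly.\<close>

lemma slice_mult:
  fixes p q :: "'a::semiring_0 mpoly"
  assumes "\<And>d e. d \<in> Poly_Mapping.keys p \<Longrightarrow> e \<in> Poly_Mapping.keys q \<Longrightarrow> Q (d + e) \<longleftrightarrow> Q' d"
  shows "slice Q (p * q) = slice Q' p * q"
proof -
  have p: "p = slice Q' p + slice (\<lambda>d. \<not> Q' d) p"
    by (rule poly_mapping_eqI) (simp add: lookup_slice lookup_add)
  have 1: "slice Q (slice Q' p * q) = slice Q' p * q"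
  proof (rule slice_eq_self)
    fix e assume "e \<in> Poly_Mapping.keys (slice Q' p * q)"
    then show "Q e" using Poly_Mapping.keys_mult[of "slice Q' p" q] assms
      by (fastforce simp: keys_slice)
  qed
  have 2: "slice Q (slice (\<lambda>d. \<not> Q' d) p * q) = 0"
  proof (rule slice_eq_0)
    fix e assume "e \<in> Poly_Mapping.keys (slice (\<lambda>d. \<not> Q' d) p * q)"
    then show "\<not> Q e" using Poly_Mapping.keys_mult[of "slice (\<lambda>d. \<not> Q' d) p" q] assms
      by (fastforce simp: keys_slice)
  qed
  show ?thesis
    by (subst p) (simp only: distrib_right slice_add 1 2 add_0_right)
qed

section \<open>Variables of products and nonvanishing of the linear forms\<close>

lemma mvars_Var: "mvars (Var i :: 'a::zero_neq_one mpoly) = {i}"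
  by (simp add: mvars_def Var_def)

lemma mvars_Const: "mvars (Const c) = {}"
  by (simp add: mvars_def Const_def)

lemma mvars_prod:
  fixes p :: "'b \<Rightarrow> 'a::field mpoly"
  assumes "\<And>i. i \<in> S \<Longrightarrow> mvars (p i) \<subseteq> W"
  shows "mvars (prod p S) \<subseteq> W"
  using assms
proof (induction S rule: infinite_finite_induct)
  case (insert x F)
  then show ?case by (simp add: mvars_mult)
qed (auto simp: mvars_def)

lemma lookup_eq_0_of_mvars:
  assumes "e \<in> Poly_Mapping.keys p" "x \<notin> mvars p"
  shows "Poly_Mapping.lookup e x = 0"
  using assms by (auto simp: mvars_def in_keys_iff)

lemma Var_neq_0: "(Var i :: 'a::zero_neq_one mpoly) \<noteq> 0"
  using mvars_Var[of i, where 'a = 'a] by (auto simp: mvars_def)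

text \<open>The coefficient of \<open>Var i\<close> is 1. With \<open>i = j\<close> it would be 2,
  which vanishes in characteristic two.\<close>

lemma linear_form_neq_0:
  assumes "i \<noteq> j"
  shows "Var i + Var j + Const c \<noteq> (0 :: 'a::field mpoly)"
proof
  assume "Var i + Var j + Const c = (0 :: 'a mpoly)"
  then have "Poly_Mapping.lookup (Var i + Var j + Const c) (Poly_Mapping.single i 1) = (0::'a)"
    by simp
  moreover have "Poly_Mapping.single j 1 \<noteq> (Poly_Mapping.single i 1 :: expvec)"
    using assms by (metis lookup_single_eq lookup_single_not_eq zero_neq_one)
  moreover have "(0 :: expvec) \<noteq> Poly_Mapping.single i 1"
    by (metis lookup_single_eq lookup_zero zero_neq_one)
  ultimately show False
    by (simp add: lookup_add Var_def Const_def lookup_single)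
qed

section \<open>Triangular exponent lists\<close>

text \<open>Each list entry marks a row and a column meeting in an occupied diagonal position; the
  row of an earlier entry and the column of a later one meet in an empty one. Only the support of
  \<open>h\<close> enters, so the notion serves both over \<open>ratfuns W\<close> and over the base
  field.\<close>

definition triangular :: "nat set \<Rightarrow> nat set \<Rightarrow> 'a::zero mpoly \<Rightarrow> expvec list \<Rightarrow> bool" where
  "triangular U V h es \<longleftrightarrow> set es \<subseteq> Poly_Mapping.keys h \<and>
     sorted_wrt (\<lambda>e e'. \<forall>d\<in>Poly_Mapping.keys h. \<not> (agree U d e \<and> agree V d e')) es"

definition bideg :: "nat \<Rightarrow> nat \<Rightarrow> nat \<Rightarrow> nat \<Rightarrow> expvec \<Rightarrow> bool" where
  "bideg u v i j e \<longleftrightarrow> Poly_Mapping.lookup e u = i \<and> Poly_Mapping.lookup e v = j"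

text \<open>
  The homogeneous part of \<open>g\<close> of top degree \<open>D\<close> in \<open>u\<close>, \<open>v\<close> is multiplied by \<open>u + v\<close>, which
  strictly widens its support: the extreme monomials \<open>u\<^sup>k v\<^sup>l\<close> with largest and smallest \<open>k\<close> give
  \<open>u\<^bsup>k+1\<^esup> v\<^sup>l\<close> and \<open>u\<^sup>k v\<^bsup>l+1\<^esup>\<close>, neither of which can cancel.
\<close>

lemma extreme_slices:
  fixes g :: "'a::field mpoly"
  assumes "g \<noteq> 0" "u \<noteq> v"
  obtains i j i' j' where "i < i'" "i + j = i' + j'"
    "slice (bideg u v i j) (g * (Var u + Var v + Const c)) \<noteq> 0"
    "slice (bideg u v i' j') (g * (Var u + Var v + Const c)) \<noteq> 0"
    "\<And>e. e \<in> Poly_Mapping.keys (g * (Var u + Var v + Const c)) \<Longrightarrow>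
      Poly_Mapping.lookup e u + Poly_Mapping.lookup e v \<le> i + j"
proof -
  let ?L = "Var u + Var v + Const c"
  let ?d = "\<lambda>e. Poly_Mapping.lookup e u + Poly_Mapping.lookup e v"
  let ?u = "\<lambda>e :: expvec. Poly_Mapping.lookup e u"
  define D where "D = Max (?d ` Poly_Mapping.keys g)"
  define T where "T = {e \<in> Poly_Mapping.keys g. ?d e = D}"
  have D_ge: "?d e \<le> D" if "e \<in> Poly_Mapping.keys g" for e
    unfolding D_def using that by simp
  have "Poly_Mapping.keys g \<noteq> {}" using assms(1) by simp
  then have "D \<in> ?d ` Poly_Mapping.keys g"
    unfolding D_def by (intro Max_in) auto
  then have T: "T \<noteq> {}" "finite T" unfolding T_def by auto
  have "Min (?u ` T) \<in> ?u ` T" "Max (?u ` T) \<in> ?u ` T" using T by simp_all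
  \<comment> \<open>In the top-degree part \<open>T\<close>, \<open>a\<close> has the least and
    \<open>b\<close> the largest exponent of \<open>u\<close>. They may coincide; the bidegrees of
    \<open>a\<close> times \<open>v\<close> and of \<open>b\<close> times \<open>u\<close> differ
    all the same.\<close>
  then obtain a b where a: "a \<in> T" "Min (?u ` T) = ?u a" and b: "b \<in> T" "Max (?u ` T) = ?u b"
    by blast
  have a_le: "?u a \<le> ?u e" if "e \<in> T" for e unfolding a(2)[symmetric] using T that by simp
  have b_ge: "?u e \<le> ?u b" if "e \<in> T" for e unfolding b(2)[symmetric] using T that by simp
  have da: "?d a = D" "a \<in> Poly_Mapping.keys g" and db: "?d b = D" "b \<in> Poly_Mapping.keys g"
    using a b unfolding T_def by auto
  have expand: "slice Q (g * ?L) = slice Q (g * Var u) + slice Q (g * Var v) + slice Q (g * Const c)" for Q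
    by (simp only: distrib_left slice_add)
  \<comment> \<open>The shift is written as \<open>+ 1 = i\<close> rather than as a subtraction, so
    that \<open>i = 0\<close> correctly yields an empty slice.\<close>
  have su: "slice (bideg u v i j) (g * Var u)
      = slice (\<lambda>e. Poly_Mapping.lookup e u + 1 = i \<and> Poly_Mapping.lookup e v = j) g * Var u" for i j
    using assms(2) by (intro slice_mult) (auto simp: Var_def bideg_def lookup_add lookup_single)
  have sv: "slice (bideg u v i j) (g * Var v)
      = slice (\<lambda>e. Poly_Mapping.lookup e u = i \<and> Poly_Mapping.lookup e v + 1 = j) g * Var v" for i j
    using assms(2) by (intro slice_mult) (auto simp: Var_def bideg_def lookup_add lookup_single)
  have sc: "slice (bideg u v i j) (g * Const c) = slice (bideg u v i j) g * Const c" for i j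
    by (intro slice_mult) (auto simp: Const_def bideg_def lookup_add split: if_splits)
  \<comment> \<open>This is the bidegree of \<open>a\<close> times \<open>v\<close>. A contribution
    through \<open>Var u\<close> would need a monomial of \<open>T\<close> with smaller exponent of
    \<open>u\<close> than \<open>a\<close>, and one through the constant a monomial of degree
    \<open>D + 1\<close> in \<open>g\<close>.\<close>
  have lo: "slice (bideg u v (?u a) (D - ?u a + 1)) (g * ?L)
      = slice (\<lambda>e. ?u e = ?u a \<and> Poly_Mapping.lookup e v + 1 = D - ?u a + 1) g * Var v"
  proof -
    have "slice (\<lambda>e. ?u e + 1 = ?u a \<and> Poly_Mapping.lookup e v = D - ?u a + 1) g = 0"
    proof (rule slice_eq_0)
      fix e assume e: "e \<in> Poly_Mapping.keys g"
      show "\<not> (?u e + 1 = ?u a \<and> Poly_Mapping.lookup e v = D - ?u a + 1)"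
        using a_le[of e] e da unfolding T_def by auto
    qed
    moreover have "slice (bideg u v (?u a) (D - ?u a + 1)) g = 0"
      using D_ge da by (intro slice_eq_0) (fastforce simp: bideg_def)
    ultimately show ?thesis
      unfolding expand su sv sc by simp
  qed
  have hi: "slice (bideg u v (?u b + 1) (D - ?u b)) (g * ?L)
      = slice (\<lambda>e. ?u e + 1 = ?u b + 1 \<and> Poly_Mapping.lookup e v = D - ?u b) g * Var u"
  proof -
    have "slice (\<lambda>e. ?u e = ?u b + 1 \<and> Poly_Mapping.lookup e v + 1 = D - ?u b) g = 0"
    proof (rule slice_eq_0)
      fix e assume e: "e \<in> Poly_Mapping.keys g"
      show "\<not> (?u e = ?u b + 1 \<and> Poly_Mapping.lookup e v + 1 = D - ?u b)"
        using b_ge[of e] e db unfolding T_def by auto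
    qed
    moreover have "slice (bideg u v (?u b + 1) (D - ?u b)) g = 0"
      using D_ge db by (intro slice_eq_0) (fastforce simp: bideg_def)
    ultimately show ?thesis
      unfolding expand su sv sc by simp
  qed
  have na: "a \<in> Poly_Mapping.keys (slice (\<lambda>e. ?u e = ?u a \<and> Poly_Mapping.lookup e v + 1 = D - ?u a + 1) g)"
    using da by (auto simp: keys_slice)
  have nb: "b \<in> Poly_Mapping.keys (slice (\<lambda>e. ?u e + 1 = ?u b + 1 \<and> Poly_Mapping.lookup e v = D - ?u b) g)"
    using db by (auto simp: keys_slice)
  show ?thesis
  proof (rule that)
    show "?u a < ?u b + 1" using a_le[OF b(1)] by simp
    show "?u a + (D - ?u a + 1) = ?u b + 1 + (D - ?u b)" using da db by simp
    show "slice (bideg u v (?u a) (D - ?u a + 1)) (g * ?L) \<noteq> 0"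
      unfolding lo using na Var_neq_0 by (auto simp del: keys_eq_empty)
    show "slice (bideg u v (?u b + 1) (D - ?u b)) (g * ?L) \<noteq> 0"
      unfolding hi using nb Var_neq_0 by (auto simp del: keys_eq_empty)
    fix e assume "e \<in> Poly_Mapping.keys (g * ?L)"
    then obtain x y where xy: "x \<in> Poly_Mapping.keys g" "y \<in> Poly_Mapping.keys ?L" "e = x + y"
      using Poly_Mapping.keys_mult[of g ?L] by blast
    have "y \<in> Poly_Mapping.keys (Var u :: 'a mpoly) \<union> Poly_Mapping.keys (Var v :: 'a mpoly) \<union> Poly_Mapping.keys (Const c)"
      using xy(2) Poly_Mapping.keys_add[of "Var u + Var v" "Const c"]
        Poly_Mapping.keys_add[of "Var u" "Var v :: 'a mpoly"] by blast
    then have "?d y \<le> 1" using assms(2)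
      by (auto simp: Var_def Const_def lookup_single split: if_splits)
    then show "?d e \<le> ?u a + (D - ?u a + 1)"
      using D_ge[OF xy(1)] da by (simp add: xy(3) lookup_add)
  qed
qed

text \<open>The multiplier \<open>g\<close> is arbitrary in the induction because the two extreme
  slices of \<open>g * L\<close> take its place for the remaining pairs.\<close>

lemma triangular_list_exists:
  fixes g :: "'a::field mpoly"
  assumes "finite U" "inj_on \<beta> U" "\<beta> ` U \<inter> U = {}" "g \<noteq> 0"
  shows "\<exists>es. length es = 2 ^ card U \<and>
    triangular U (\<beta> ` U) (g * (\<Prod>u\<in>U. Var u + Var (\<beta> u) + Const (\<gamma> u))) es"
  using assms
proof (induction U arbitrary: g rule: finite_induct)
  case empty
  then obtain e where "e \<in> Poly_Mapping.keys g" by fastforce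
  then show ?case by (intro exI[of _ "[e]"]) (auto simp: triangular_def)
next
  case (insert u U)
  define v where "v = \<beta> u"
  define L where "L = Var u + Var v + Const (\<gamma> u)"
  define R where "R = (\<Prod>u\<in>U. Var u + Var (\<beta> u) + Const (\<gamma> u))"
  define h where "h = g * L * R"
  have h: "g * (\<Prod>u\<in>insert u U. Var u + Var (\<beta> u) + Const (\<gamma> u)) = h"
    using insert.hyps by (simp add: h_def R_def L_def v_def mult.assoc)
  have uv: "u \<noteq> v" "v \<notin> U" "u \<notin> \<beta> ` U" "v \<notin> \<beta> ` U"
    using insert.prems insert.hyps by (auto simp: v_def)
  obtain i j i' j' where ij: "i < i'" "i + j = i' + j'"
    "slice (bideg u v i j) (g * L) \<noteq> 0" "slice (bideg u v i' j') (g * L) \<noteq> 0"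
    "\<And>e. e \<in> Poly_Mapping.keys (g * L) \<Longrightarrow>
      Poly_Mapping.lookup e u + Poly_Mapping.lookup e v \<le> i + j"
    by (rule extreme_slices[OF \<open>g \<noteq> 0\<close> uv(1), of "\<gamma> u", folded L_def]) (rule that)
  \<comment> \<open>The remaining factors involve neither \<open>u\<close> nor \<open>v\<close>, so
    slicing \<open>h\<close> by bidegree only slices \<open>g * L\<close>.\<close>
  have "mvars R \<subseteq> U \<union> \<beta> ` U" unfolding R_def
    by (intro mvars_prod mvars_add) (auto simp: mvars_Var mvars_Const)
  then have R0: "Poly_Mapping.lookup e u = 0" "Poly_Mapping.lookup e v = 0"
    if "e \<in> Poly_Mapping.keys R" for e
    using lookup_eq_0_of_mvars[OF that] uv insert.hyps by blast+
  have slice_h: "slice (bideg u v k l) h = slice (bideg u v k l) (g * L) * R" for k l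
    unfolding h_def by (rule slice_mult) (simp add: bideg_def lookup_add R0)
  have deg_h: "Poly_Mapping.lookup e u + Poly_Mapping.lookup e v \<le> i + j"
    if eh: "e \<in> Poly_Mapping.keys h" for e
  proof -
    obtain x y where "x \<in> Poly_Mapping.keys (g * L)" "y \<in> Poly_Mapping.keys R" "e = x + y"
      using eh Poly_Mapping.keys_mult[of "g * L" R] unfolding h_def by blast
    then show ?thesis using ij(5)[of x] by (simp add: lookup_add R0)
  qed
  have prems: "inj_on \<beta> U" "\<beta> ` U \<inter> U = {}" using insert.prems by auto
  obtain es' where es': "length es' = 2 ^ card U" "triangular U (\<beta> ` U) (slice (bideg u v i' j') h) es'"
    using insert.IH[OF prems ij(4)] unfolding R_def[symmetric] slice_h[symmetric] by blast
  obtain es where es: "length es = 2 ^ card U" "triangular U (\<beta> ` U) (slice (bideg u v i j) h) es"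
    using insert.IH[OF prems ij(3)] unfolding R_def[symmetric] slice_h[symmetric] by blast
  \<comment> \<open>A monomial of \<open>h\<close> sharing its \<open>u\<close>-exponent with
    \<open>e\<close> and its \<open>v\<close>-exponent with \<open>e'\<close> has bidegree
    \<open>k\<close>, \<open>l\<close>, hence already lies in the slice.\<close>
  have lift: "triangular (insert u U) (\<beta> ` insert u U) h es"
    if "triangular U (\<beta> ` U) (slice (bideg u v k l) h) es" for es k l
  proof -
    have k: "set es \<subseteq> {e \<in> Poly_Mapping.keys h. bideg u v k l e}"
      using that unfolding triangular_def keys_slice by blast
    moreover have "sorted_wrt (\<lambda>e e'. \<forall>d\<in>Poly_Mapping.keys h.
        \<not> (agree (insert u U) d e \<and> agree (\<beta> ` insert u U) d e')) es"
    proof (rule sorted_wrt_mono_rel)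
      show "sorted_wrt (\<lambda>e e'. \<forall>d\<in>Poly_Mapping.keys (slice (bideg u v k l) h).
          \<not> (agree U d e \<and> agree (\<beta> ` U) d e')) es"
        using that unfolding triangular_def by blast
    next
      fix e e' assume "e \<in> set es" "e' \<in> set es"
        "\<forall>d\<in>Poly_Mapping.keys (slice (bideg u v k l) h). \<not> (agree U d e \<and> agree (\<beta> ` U) d e')"
      then show "\<forall>d\<in>Poly_Mapping.keys h.
          \<not> (agree (insert u U) d e \<and> agree (\<beta> ` insert u U) d e')"
        using k by (auto simp: agree_def keys_slice bideg_def v_def subset_iff)
    qed
    ultimately show ?thesis unfolding triangular_def by blast
  qed
  have "triangular (insert u U) (\<beta> ` insert u U) h (es' @ es)"
  proof -
    \<comment> \<open>Such a \<open>d\<close> would have exponents \<open>i'\<close> in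
      \<open>u\<close> and \<open>j\<close> in \<open>v\<close>, and \<open>i' + j > i + j\<close>
      exceeds the top degree. This is why \<open>es'\<close> precedes \<open>es\<close>.\<close>
    have "\<not> (agree (insert u U) d e \<and> agree (\<beta> ` insert u U) d e')"
      if "e \<in> set es'" "e' \<in> set es" "d \<in> Poly_Mapping.keys h" for d e e'
    proof -
      have "bideg u v i' j' e" "bideg u v i j e'"
        using es'(2) es(2) that unfolding triangular_def keys_slice by blast+
      then show ?thesis
        using deg_h[OF that(3)] ij(1,2) by (auto simp: agree_def bideg_def v_def)
    qed
    then show ?thesis
      using lift[OF es(2)] lift[OF es'(2)] by (auto simp: triangular_def sorted_wrt_append)
  qed
  moreover have "length (es' @ es) = 2 ^ card (insert u U)"
    using es(1) es'(1) insert.hyps by simp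
  ultimately show ?case unfolding h by blast
qed

section \<open>Lower bound for the coefficient dimension\<close>

lemma lookup_times:
  fixes p q :: "'a::comm_ring_1 mpoly"
  shows "Poly_Mapping.lookup (p * q) k = (\<Sum>d\<in>Poly_Mapping.keys p. \<Sum>e\<in>Poly_Mapping.keys q.
    if d + e = k then Poly_Mapping.lookup p d * Poly_Mapping.lookup q e else 0)"
proof -
  have expand: "p = (\<Sum>e\<in>Poly_Mapping.keys p. Poly_Mapping.single e (Poly_Mapping.lookup p e))" for p :: "'a mpoly"
    by (rule poly_mapping_eqI) (auto simp: lookup_sum lookup_single when_def in_keys_iff)
  have "p * q = (\<Sum>d\<in>Poly_Mapping.keys p. Poly_Mapping.single d (Poly_Mapping.lookup p d)) *
      (\<Sum>e\<in>Poly_Mapping.keys q. Poly_Mapping.single e (Poly_Mapping.lookup q e))"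
    using expand[of p] expand[of q] by simp
  then show ?thesis
    by (simp add: sum_product mult_single lookup_sum lookup_single when_def)
qed

lemma lookup_Const_mult:
  fixes p :: "'a::comm_ring_1 mpoly"
  shows "Poly_Mapping.lookup (Const c * p) k = c * Poly_Mapping.lookup p k"
proof (cases "c = 0")
  case False
  have "Poly_Mapping.lookup (Const c * p) k = (\<Sum>e\<in>Poly_Mapping.keys p. if e = k then c * Poly_Mapping.lookup p e else 0)"
    unfolding lookup_times Const_def using False by (simp add: lookup_single)
  then show ?thesis by (auto simp: in_keys_iff)
qed (simp add: Const_def)

text \<open>Taking the coefficient at \<open>a x\<close> is a linear functional that vanishes on all
  later vectors, hence on their span, but not on \<open>c x\<close>.\<close>

lemma independent_if_triangular:
  fixes c :: "'b \<Rightarrow> 'a::field mpoly"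
  assumes "sorted_wrt (\<lambda>x y. Poly_Mapping.lookup (c y) (a x) = 0) xs"
    and "\<And>x. x \<in> set xs \<Longrightarrow> Poly_Mapping.lookup (c x) (a x) \<noteq> 0"
  shows "ring.independent ring_of_type_algebra (Const ` K) (map c xs)"
proof -
  let ?R = "ring_of_type_algebra :: 'a mpoly ring"
  interpret ring ?R by (rule ring_from_type_algebra)
  have R: "carrier ?R = UNIV" "\<And>x y. x \<otimes>\<^bsub>?R\<^esub> y = x * y" "\<And>x y. x \<oplus>\<^bsub>?R\<^esub> y = x + y"
    "\<zero>\<^bsub>?R\<^esub> = 0"
    by (auto simp: ring_of_type_algebra_def)
  have span: "Poly_Mapping.lookup p e = 0"
    if "p \<in> Span (Const ` K) us" "\<forall>u\<in>set us. Poly_Mapping.lookup u e = 0" for p us e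
    using that by (induction us arbitrary: p)
      (auto simp: R line_extension_mem_iff lookup_add lookup_Const_mult)
  show ?thesis
    using assms
  proof (induction xs)
    case (Cons x xs)
    have "c x \<notin> Span (Const ` K) (map c xs)"
    proof
      assume "c x \<in> Span (Const ` K) (map c xs)"
      then have "Poly_Mapping.lookup (c x) (a x) = 0"
        by (rule span) (use Cons.prems in auto)
      then show False using Cons.prems(2)[of x] by simp
    qed
    then show ?case
      using Cons by (auto intro!: li_Cons simp: R simp del: Span.simps)
  qed simp
qed

text \<open>The span of \<open>us\<close> is one of the spans whose union is
  \<open>poly_span\<close>, so \<open>us\<close> is an independent list inside a finite-dimensional
  space.\<close>

lemma length_le_poly_dim:
  fixes S :: "'a::field ratfun mpoly set"
  assumes "finite S" "set us \<subseteq> S"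
    and "ring.independent ring_of_type_algebra (Const ` ratfuns W) us"
  shows "length us \<le> poly_dim (ratfuns W) S"
proof -
  let ?R = "ring_of_type_algebra :: 'a ratfun mpoly ring"
  interpret ring ?R by (rule ring_from_type_algebra)
  have "us \<in> {us. set us \<subseteq> S}" using assms(2) by simp
  moreover have "set us \<subseteq> Span (Const ` ratfuns W) us"
    using Span_base_incl[OF subfield_Const_ratfuns independent_in_carrier[OF assms(3)]] .
  ultimately have "set us \<subseteq> poly_span (ratfuns W) S"
    unfolding poly_span_def by blast
  with finite_dimensionE[OF subfield_Const_ratfuns poly_span_finite_dim[OF assms(1)], of W] assms(3)
  show ?thesis
    unfolding poly_dim_def over_def using independent_length_le_dimension[OF subfield_Const_ratfuns] by blast
qed

section \<open>Coefficient matrices over the rational functions\<close>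

lemma sum_Fract_1: "(\<Sum>x\<in>A. Fract (f x) 1) = Fract (\<Sum>x\<in>A. f x :: 'a::idom) 1"
  by (induction A rule: infinite_finite_induct) (auto simp: Zero_fract_def)

text \<open>No cancellation occurs: monomials of \<open>h\<close> with equal parts outside
  \<open>W\<close> have distinct parts in \<open>W\<close>, so they stay separate in the numerator
  of the coefficient.\<close>

lemma keys_over_ratfuns:
  fixes h :: "'a::field mpoly"
  shows "Poly_Mapping.keys (over_ratfuns W h) = restrict_exp (- W) ` Poly_Mapping.keys h"
proof (intro equalityI subsetI)
  fix d assume "d \<in> Poly_Mapping.keys (over_ratfuns W h)"
  then show "d \<in> restrict_exp (- W) ` Poly_Mapping.keys h"
    unfolding over_ratfuns_def in_keys_iff lookup_sum lookup_single
    by (elim sum.not_neutral_contains_not_neutral) (auto simp: when_def split: if_splits)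
next
  fix d assume "d \<in> restrict_exp (- W) ` Poly_Mapping.keys h"
  then obtain e where e: "e \<in> Poly_Mapping.keys h" "d = restrict_exp (- W) e" by blast
  \<comment> \<open>The numerator collected at \<open>d\<close>. Its coefficient at the
    \<open>W\<close>-part of \<open>e\<close> comes from \<open>e\<close> alone, since the parts
    inside and outside \<open>W\<close> determine an exponent.\<close>
  define s where "s = (\<Sum>e'\<in>Poly_Mapping.keys h. if agree (- W) e' e
    then Poly_Mapping.single (restrict_exp W e') (Poly_Mapping.lookup h e') else 0)"
  have "Poly_Mapping.lookup (over_ratfuns W h) d = (\<Sum>e'\<in>Poly_Mapping.keys h. Fract (if agree (- W) e' e
    then Poly_Mapping.single (restrict_exp W e') (Poly_Mapping.lookup h e') else 0) 1)"
    unfolding over_ratfuns_def lookup_sum lookup_single e restrict_exp_eq_iff when_def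
    by (intro sum.cong) (auto simp: Zero_fract_def)
  then have lk: "Poly_Mapping.lookup (over_ratfuns W h) d = Fract s 1"
    unfolding s_def sum_Fract_1 .
  have "Poly_Mapping.lookup s (restrict_exp W e) = (\<Sum>e'\<in>Poly_Mapping.keys h.
      if e' = e then Poly_Mapping.lookup h e' else 0)"
    unfolding s_def lookup_sum
  proof (intro sum.cong refl)
    fix e' :: expvec
    have "agree W e' e \<and> agree (- W) e' e \<longleftrightarrow> e' = e"
      by (auto simp: agree_def intro: poly_mapping_eqI)
    then show "Poly_Mapping.lookup (if agree (- W) e' e
        then Poly_Mapping.single (restrict_exp W e') (Poly_Mapping.lookup h e') else 0) (restrict_exp W e)
      = (if e' = e then Poly_Mapping.lookup h e' else 0)"
      by (auto simp: lookup_single when_def restrict_exp_eq_iff agree_def)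
  qed
  then have "s \<noteq> 0" using e(1) by (auto simp: in_keys_iff)
  then show "d \<in> Poly_Mapping.keys (over_ratfuns W h)"
    by (simp add: in_keys_iff lk eq_fract Zero_fract_def)
qed

lemma lookup_coeff_at:
  "Poly_Mapping.lookup (coeff_at U V h b) a =
     (\<Sum>e | e \<in> Poly_Mapping.keys h \<and> restrict_exp V e = b \<and> restrict_exp U e = a. Poly_Mapping.lookup h e)"
proof -
  have "Poly_Mapping.lookup (coeff_at U V h b) a =
     (\<Sum>e | e \<in> Poly_Mapping.keys h \<and> restrict_exp V e = b.
        if restrict_exp U e = a then Poly_Mapping.lookup h e else 0)"
    unfolding coeff_at_def lookup_sum lookup_single when_def ..
  also have "\<dots> = (\<Sum>e | e \<in> Poly_Mapping.keys h \<and> restrict_exp V e = b \<and> restrict_exp U e = a. Poly_Mapping.lookup h e)"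
    by (rule sum.mono_neutral_cong_right) auto
  finally show ?thesis .
qed

text \<open>The coefficients at the \<open>V\<close>-parts of \<open>es\<close>, tested at the
  \<open>U\<close>-parts, form a triangular matrix over \<open>ratfuns W\<close> with nonzero
  diagonal.\<close>

lemma poly_dim_Coeffs_ge:
  fixes h :: "'a::field mpoly"
  assumes "triangular U V h es" "mvars h \<subseteq> U \<union> V \<union> W" "(U \<union> V) \<inter> W = {}"
  shows "length es \<le> poly_dim (ratfuns W) (Coeffs U V (over_ratfuns W h))"
proof -
  define H where "H = over_ratfuns W h"
  define c where "c e = coeff_at U V H (restrict_exp V e)" for e
  have keysH: "Poly_Mapping.keys H = restrict_exp (- W) ` Poly_Mapping.keys h"
    unfolding H_def by (rule keys_over_ratfuns)
  have agree_rex: "agree S (restrict_exp (- W) d) e \<longleftrightarrow> agree S d e" if "S \<subseteq> U \<union> V" for S d e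
    using that assms(3) by (auto simp: agree_def lookup_restrict_exp)
  have lookup_c: "Poly_Mapping.lookup (c e') (restrict_exp U e) =
      (\<Sum>d | d \<in> Poly_Mapping.keys H \<and> agree V d e' \<and> agree U d e. Poly_Mapping.lookup H d)" for e e'
    unfolding c_def lookup_coeff_at restrict_exp_eq_iff ..
  have off: "Poly_Mapping.lookup (c e') (restrict_exp U e) = 0"
    if "\<forall>d\<in>Poly_Mapping.keys h. \<not> (agree U d e \<and> agree V d e')" for e e'
  proof -
    have "{d. d \<in> Poly_Mapping.keys H \<and> agree V d e' \<and> agree U d e} = {}"
      using that unfolding keysH by (auto simp: agree_rex)
    then show ?thesis unfolding lookup_c by (simp only: sum.empty)
  qed
  \<comment> \<open>Once the \<open>W\<close>-part has moved into the coefficient, the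
    \<open>U\<close>- and \<open>V\<close>-parts determine the monomial, so the sum giving the entry
    has a single nonzero term.\<close>
  have diag: "Poly_Mapping.lookup (c e) (restrict_exp U e) \<noteq> 0" if e: "e \<in> Poly_Mapping.keys h" for e
  proof -
    have "{d. d \<in> Poly_Mapping.keys H \<and> agree V d e \<and> agree U d e} = {restrict_exp (- W) e}"
    proof (intro equalityI subsetI)
      fix d assume "d \<in> {d. d \<in> Poly_Mapping.keys H \<and> agree V d e \<and> agree U d e}"
      then obtain d' where d': "d' \<in> Poly_Mapping.keys h" "d = restrict_exp (- W) d'"
        "agree V d' e" "agree U d' e"
        unfolding keysH by (auto simp: agree_rex)
      have "agree (- W) d' e"
        unfolding agree_def
      proof
        fix x assume x: "x \<in> - W"
        show "Poly_Mapping.lookup d' x = Poly_Mapping.lookup e x"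
        proof (cases "x \<in> U \<union> V")
          case False
          then have "x \<notin> mvars h" using x assms(2) by blast
          then show ?thesis using d'(1) e lookup_eq_0_of_mvars by metis
        qed (use d' in \<open>auto simp: agree_def\<close>)
      qed
      then show "d \<in> {restrict_exp (- W) e}" using d'(2) by (simp add: restrict_exp_eq_iff)
    next
      fix d assume "d \<in> {restrict_exp (- W) e}"
      then show "d \<in> {d. d \<in> Poly_Mapping.keys H \<and> agree V d e \<and> agree U d e}"
        using e unfolding keysH by (auto simp: agree_rex) (auto simp: agree_def)
    qed
    moreover have "restrict_exp (- W) e \<in> Poly_Mapping.keys H" using e unfolding keysH by blast
    ultimately show ?thesis unfolding lookup_c by (simp add: in_keys_iff)
  qed
  have "ring.independent ring_of_type_algebra (Const ` ratfuns W) (map c es)"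
  proof (rule independent_if_triangular[where a = "restrict_exp U"])
    show "sorted_wrt (\<lambda>x y. Poly_Mapping.lookup (c y) (restrict_exp U x) = 0) es"
      using assms(1) unfolding triangular_def
      by (auto intro: sorted_wrt_mono_rel[rotated] off)
  qed (use diag assms(1) in \<open>auto simp: triangular_def\<close>)
  moreover have "set (map c es) \<subseteq> Coeffs U V H"
  proof -
    have "Poly_Mapping.keys (restrict_exp V e) \<subseteq> V" for e
      by (auto simp: in_keys_iff lookup_restrict_exp split: if_splits)
    then show ?thesis unfolding Coeffs_def c_def by auto
  qed
  ultimately show ?thesis
    using length_le_poly_dim[OF finite_Coeffs, of "map c es"] unfolding H_def by simp
qed

section \<open>Width of roABPs\<close>

text \<open>Every coefficient of \<open>h\<close> with respect to the variables outside
  \<open>U\<close> is a combination of the polynomials \<open>p q\<close>, so these coefficients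
  span dimension at most \<open>card Q\<close>; triangularity makes \<open>length es\<close> of them
  independent.\<close>

lemma length_le_card_if_factored:
  fixes p r :: "'b \<Rightarrow> 'a::field mpoly"
  assumes "finite Q" "h = (\<Sum>q\<in>Q. p q * r q)"
    and p: "\<And>q. q \<in> Q \<Longrightarrow> mvars (p q) \<subseteq> U"
    and r: "\<And>q. q \<in> Q \<Longrightarrow> mvars (r q) \<inter> U = {}"
    and "triangular U V h es" "U \<inter> V = {}"
  shows "length es \<le> card Q"
proof -
  \<comment> \<open>The scalars here form a whole type, so dimension theory for
    \<open>vector_space\<close> applies, unlike over the set \<open>ratfuns W\<close>.\<close>
  interpret vs: vector_space "\<lambda>c (p :: 'a mpoly). Const c * p"
  proof
    fix a b :: 'a and x y :: "'a mpoly"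
    show "Const a * (x + y) = Const a * x + Const a * y" by (rule distrib_left)
    show "Const (a + b) * x = Const a * x + Const b * x"
      by (simp add: Const_def single_add distrib_right)
    show "Const a * (Const b * x) = Const (a * b) * x"
      by (simp add: Const_def mult_single mult.assoc[symmetric])
    show "Const 1 * x = x" by (simp add: Const_def)
  qed
  \<comment> \<open>By \<open>lookup_c\<close> below, this is the coefficient in \<open>h\<close> of
    the monomial with exponent \<open>restrict_exp (- U) e\<close>. All variables outside
    \<open>U\<close> index columns, including those outside \<open>V\<close>.\<close>
  define c where "c e = (\<Sum>q\<in>Q. Const (Poly_Mapping.lookup (r q) (restrict_exp (- U) e)) * p q)" for e
  have supp: "d = restrict_exp U d" if "q \<in> Q" "d \<in> Poly_Mapping.keys (p q)" for q d
    using lookup_eq_0_of_mvars[OF that(2)] p[OF that(1)]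
    by (intro poly_mapping_eqI) (auto simp: lookup_restrict_exp)
  have supr: "d = restrict_exp (- U) d" if "q \<in> Q" "d \<in> Poly_Mapping.keys (r q)" for q d
    using lookup_eq_0_of_mvars[OF that(2)] r[OF that(1)]
    by (intro poly_mapping_eqI) (auto simp: lookup_restrict_exp)
  have split_exp: "d + d' = restrict_exp U e + restrict_exp (- U) e' \<longleftrightarrow>
      d = restrict_exp U e \<and> d' = restrict_exp (- U) e'"
    if "d = restrict_exp U d" "d' = restrict_exp (- U) d'" for d d' e e'
  proof
    assume eq: "d + d' = restrict_exp U e + restrict_exp (- U) e'"
    have *: "Poly_Mapping.lookup (restrict_exp U d + restrict_exp (- U) d') x
        = Poly_Mapping.lookup (restrict_exp U e + restrict_exp (- U) e') x" for x
      using eq that[symmetric] by (simp only:)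
    have "agree U d e"
      unfolding agree_def 
    proof
      fix x assume "x \<in> U"
      then show "Poly_Mapping.lookup d x = Poly_Mapping.lookup e x"
        using *[of x] by (simp add: lookup_add lookup_restrict_exp)
    qed
    moreover have "agree (- U) d' e'"
      unfolding agree_def 
    proof
      fix x assume "x \<in> - U"
      then show "Poly_Mapping.lookup d' x = Poly_Mapping.lookup e' x"
        using *[of x] by (simp add: lookup_add lookup_restrict_exp)
    qed
    ultimately show "d = restrict_exp U e \<and> d' = restrict_exp (- U) e'"
      using that unfolding restrict_exp_eq_iff[symmetric] by (simp only:)
  qed simp
  have lookup_c: "Poly_Mapping.lookup (c e') (restrict_exp U e)
      = Poly_Mapping.lookup h (restrict_exp U e + restrict_exp (- U) e')" for e e'
  proof -
    let ?a = "restrict_exp U e" and ?b = "restrict_exp (- U) e'"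
    have "Poly_Mapping.lookup (p q * r q) (?a + ?b) = Poly_Mapping.lookup (r q) ?b * Poly_Mapping.lookup (p q) ?a"
      if q: "q \<in> Q" for q
    proof -
      have "Poly_Mapping.lookup (p q * r q) (?a + ?b)
        = (\<Sum>d\<in>Poly_Mapping.keys (p q). \<Sum>d'\<in>Poly_Mapping.keys (r q).
            if d = ?a then if d' = ?b then Poly_Mapping.lookup (p q) d * Poly_Mapping.lookup (r q) d' else 0 else 0)"
        unfolding lookup_times
        by (intro sum.cong refl) (use split_exp supp supr q in \<open>auto split: if_splits\<close>)
      also have "\<dots> = (\<Sum>d\<in>Poly_Mapping.keys (p q).
            if d = ?a then Poly_Mapping.lookup (p q) d * Poly_Mapping.lookup (r q) ?b else 0)"
        by (intro sum.cong refl) (auto simp: in_keys_iff)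
      also have "\<dots> = Poly_Mapping.lookup (r q) ?b * Poly_Mapping.lookup (p q) ?a"
        by (auto simp: in_keys_iff)
      finally show ?thesis .
    qed
    then show ?thesis
      by (simp add: c_def assms(2) lookup_sum lookup_Const_mult)
  qed
  have off: "Poly_Mapping.lookup (c e') (restrict_exp U e) = 0"
    if "\<forall>d\<in>Poly_Mapping.keys h. \<not> (agree U d e \<and> agree V d e')" for e e'
  proof -
    have "agree U (restrict_exp U e + restrict_exp (- U) e') e"
      "agree V (restrict_exp U e + restrict_exp (- U) e') e'"
      using \<open>U \<inter> V = {}\<close> by (auto simp: agree_def lookup_add lookup_restrict_exp)
    then show ?thesis
      unfolding lookup_c using that by (auto simp: in_keys_iff)
  qed
  have diag: "Poly_Mapping.lookup (c e) (restrict_exp U e) \<noteq> 0" if "e \<in> Poly_Mapping.keys h" for e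
  proof -
    have "restrict_exp U e + restrict_exp (- U) e = e"
      by (rule poly_mapping_eqI) (simp add: lookup_add lookup_restrict_exp)
    then show ?thesis unfolding lookup_c using that by (simp add: in_keys_iff)
  qed
  have "vs.independent (c ` set es) \<and> card (c ` set es) = length es"
    using assms(5) unfolding triangular_def
  proof (induction es)
    case (Cons e es)
    have "c ` set es \<subseteq> {x. Poly_Mapping.lookup x (restrict_exp U e) = 0}"
      using Cons.prems off by auto
    moreover have "vs.subspace {x. Poly_Mapping.lookup x (restrict_exp U e) = 0}"
      by (auto simp: vs.subspace_def lookup_add lookup_Const_mult)
    ultimately have "vs.span (c ` set es) \<subseteq> {x. Poly_Mapping.lookup x (restrict_exp U e) = 0}"
      by (rule vs.span_minimal)
    then have "c e \<notin> vs.span (c ` set es)"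
      using diag[of e] Cons.prems by auto
    moreover from this have "c e \<notin> c ` set es" using vs.span_base by blast
    ultimately show ?case
      using Cons by (auto simp: vs.independent_insert)
  qed (simp add: vs.independent_empty)
  moreover have "c ` set es \<subseteq> vs.span (p ` Q)"
    unfolding c_def by (intro image_subsetI vs.span_sum vs.span_scale vs.span_base imageI)
  ultimately have "length es \<le> card (p ` Q)"
    using vs.independent_span_bound[of "p ` Q" "c ` set es"] assms(1) by auto
  also have "\<dots> \<le> card Q" by (rule card_image_le[OF assms(1)])
  finally show ?thesis .
qed

text \<open>Each arc climbs exactly one layer, so a walk never revisits a vertex and reads the
  variables in order. Walks and paths thus coincide, and concatenated paths are again paths.\<close>

lemma roabp_awalk:
  fixes A :: "('v, 'e, 'a::field) abp"
  assumes "is_roabp vs r A" "pre_digraph.awalk (graph A) u es w" "u \<in> layer A i" "i \<le> length vs"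
  shows "i + length es \<le> length vs" "w \<in> layer A (i + length es)"
    "pre_digraph.apath (graph A) u es w"
    "mvars (prod_list (map (label A) es)) \<subseteq> set (take (length es) (drop i vs))"
proof -
  interpret fin_digraph "graph A" using assms(1) by (simp add: is_roabp_def)
  have disj: "j = k" if "x \<in> layer A j" "x \<in> layer A k" "j \<le> length vs" "k \<le> length vs" for x j k
    using assms(1) that unfolding is_roabp_def by blast
  \<comment> \<open>The claim about \<open>awalk_verts\<close> strengthens the induction: the rest
    of the walk stays in layers from \<open>Suc i\<close> on and so avoids \<open>u\<close>.\<close>
  have "i + length es \<le> length vs \<and> w \<in> layer A (i + length es) \<and> apath u es w \<and>
     set (awalk_verts u es) \<subseteq> (\<Union>j\<in>{i..length vs}. layer A j) \<and>
     mvars (prod_list (map (label A) es)) \<subseteq> set (take (length es) (drop i vs))"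
    using assms(2-4)
  proof (induction es arbitrary: u i)
    case Nil
    then show ?case by (auto simp: awalk_Nil_iff apath_Nil_iff mvars_def)
  next
    case (Cons e es)
    have e: "e \<in> arcs (graph A)" "u = tail (graph A) e" "awalk (head (graph A) e) es w"
      using Cons.prems by (auto simp: awalk_Cons_iff)
    obtain k where k: "k \<in> {1..length vs}" "u \<in> layer A (k - 1)" "head (graph A) e \<in> layer A k"
      "mvars (label A e) \<subseteq> {vs ! (k - 1)}"
      using assms(1) e unfolding is_roabp_def by blast
    then have "k - 1 = i" using disj[OF k(2) Cons.prems(2)] Cons.prems(3) by auto
    then have ki: "k = Suc i" "i < length vs" using k(1) by auto
    note IH = Cons.IH[OF e(3) k(3)[unfolded ki(1)]]
    from ki have "Suc i \<le> length vs" by simp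
    note IH = IH[OF this]
    have "u \<notin> layer A j" if "j \<in> {Suc i..length vs}" for j
    proof
      assume "u \<in> layer A j"
      then have "i = j" using disj[OF Cons.prems(2)] that ki by simp
      then show False using that by simp
    qed
    then have "u \<notin> set (awalk_verts (head (graph A) e) es)"
      using IH by blast
    then have "apath u (e # es) w"
      using IH e by (simp add: apath_Cons_iff)
    moreover have "set (awalk_verts u (e # es)) \<subseteq> (\<Union>j\<in>{i..length vs}. layer A j)"
    proof -
      have "(\<Union>j\<in>{Suc i..length vs}. layer A j) \<subseteq> (\<Union>j\<in>{i..length vs}. layer A j)" by fastforce
      moreover have "u \<in> (\<Union>j\<in>{i..length vs}. layer A j)" using Cons.prems by auto
      ultimately show ?thesis using IH e(2) by auto
    qed
    moreover have "mvars (prod_list (map (label A) (e # es))) \<subseteq> set (take (length (e # es)) (drop i vs))"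
    proof -
      have "drop i vs = vs ! i # drop (Suc i) vs" using ki(2) by (rule Cons_nth_drop_Suc[symmetric])
      moreover have "mvars (label A e * prod_list (map (label A) es))
          \<subseteq> insert (vs ! i) (set (take (length es) (drop (Suc i) vs)))"
        using IH ki k(4) by (intro mvars_mult) auto
      ultimately show ?thesis by simp
    qed
    ultimately show ?case using IH ki by simp
  qed
  then show "i + length es \<le> length vs" "w \<in> layer A (i + length es)"
    "pre_digraph.apath (graph A) u es w"
    "mvars (prod_list (map (label A) es)) \<subseteq> set (take (length es) (drop i vs))"
    by auto
qed

lemma mvars_sum:
  fixes p :: "'b \<Rightarrow> 'a::field mpoly"
  assumes "\<And>i. i \<in> S \<Longrightarrow> mvars (p i) \<subseteq> W"
  shows "mvars (sum p S) \<subseteq> W"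
  using assms
proof (induction S rule: infinite_finite_induct)
  case (insert x F)
  then show ?case by (simp add: mvars_add)
qed (auto simp: mvars_def)

text \<open>Every source-sink path meets layer \<open>m\<close> in exactly one vertex
  \<open>x\<close>. Cutting there turns the sum over paths through \<open>x\<close> into a product
  of two sums.\<close>

lemma roabp_factored:
  fixes A :: "('v, 'e, 'a::field) abp"
  assumes "is_roabp vs r A" "m \<le> length vs"
  obtains p q :: "'v \<Rightarrow> 'a mpoly" where
    "abp_poly A = (\<Sum>x\<in>layer A m. p x * q x)"
    "\<And>x. x \<in> layer A m \<Longrightarrow> mvars (p x) \<subseteq> set (take m vs)"
    "\<And>x. x \<in> layer A m \<Longrightarrow> mvars (q x) \<subseteq> set (drop m vs)"
proof -
  interpret fin_digraph "graph A" using assms(1) by (simp add: is_roabp_def)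
  have disj: "j = k" if "x \<in> layer A j" "x \<in> layer A k" "j \<le> length vs" "k \<le> length vs" for x j k
    using assms(1) that unfolding is_roabp_def by blast
  have s: "source A \<in> layer A 0" and t: "sink A \<in> layer A (length vs)"
    using assms(1) by (auto simp: is_roabp_def)
  have "layer A m \<subseteq> verts (graph A)" using assms by (auto simp: is_roabp_def)
  then have fin: "finite (layer A m)" using finite_verts finite_subset by blast
  define w where "w es = prod_list (map (label A) es)" for es
  define P where "P x = {es. apath (source A) es x}" for x
  define Q where "Q x = {es. apath x es (sink A)}" for x
  have fins: "finite (P x)" "finite (Q x)" for x
    unfolding P_def Q_def by (rule apaths_finite)+
  \<comment> \<open>The fixed length makes \<open>take m\<close> and \<open>drop m\<close> recover
    the two pieces of a concatenated path.\<close>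
  have P_len: "length es = m" if "x \<in> layer A m" "es \<in> P x" for x es
  proof -
    have aw: "awalk (source A) es x" using that(2) by (simp add: P_def apath_def)
    show ?thesis
      using disj[OF that(1)] roabp_awalk(1,2)[OF assms(1) aw s] assms(2) by simp
  qed
  have split: "abp_poly A = (\<Sum>(x, es1, es2)\<in>(SIGMA x:layer A m. P x \<times> Q x). w (es1 @ es2))"
    unfolding abp_poly_def w_def[symmetric]
  proof (rule sum.reindex_bij_witness[where j = "\<lambda>es. (awlast (source A) (take m es), take m es, drop m es)"
        and i = "\<lambda>(x, es1, es2). es1 @ es2"])
    fix es assume "es \<in> {es. apath (source A) es (sink A)}"
    then have es: "awalk (source A) es (sink A)" by (simp add: apath_def)
    have len: "length es = length vs"
      using disj[OF _ t] roabp_awalk(1,2)[OF assms(1) es s] by simp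
    let ?x = "awlast (source A) (take m es)"
    have "awalk (source A) (take m es @ drop m es) (sink A)" using es by simp
    then have aw: "awalk (source A) (take m es) ?x" "awalk ?x (drop m es) (sink A)"
      unfolding awalk_append_iff by blast+
    have x: "?x \<in> layer A m" using roabp_awalk(2)[OF assms(1) aw(1) s] len assms(2) by simp
    show "(?x, take m es, drop m es) \<in> (SIGMA x:layer A m. P x \<times> Q x)"
      using x roabp_awalk(3)[OF assms(1) aw(1) s] roabp_awalk(3)[OF assms(1) aw(2) x] assms(2)
      by (auto simp: P_def Q_def)
  next
    fix y assume "y \<in> (SIGMA x:layer A m. P x \<times> Q x)"
    then obtain x es1 es2 where y: "y = (x, es1, es2)" "x \<in> layer A m" "es1 \<in> P x" "es2 \<in> Q x"
      by auto
    have aw: "awalk (source A) es1 x" "awalk x es2 (sink A)" using y by (auto simp: P_def Q_def apath_def)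
    have ends: "awlast (source A) es1 = x" using aw(1) by auto
    have "awalk (source A) (es1 @ es2) (sink A)" using aw ends by simp
    then show "(case y of (x, es1, es2) \<Rightarrow> es1 @ es2) \<in> {es. apath (source A) es (sink A)}"
      using roabp_awalk(3)[OF assms(1) _ s] y by simp
    show "(awlast (source A) (take m (case y of (x, es1, es2) \<Rightarrow> es1 @ es2)),
        take m (case y of (x, es1, es2) \<Rightarrow> es1 @ es2), drop m (case y of (x, es1, es2) \<Rightarrow> es1 @ es2)) = y"
      using P_len[OF y(2,3)] ends by (simp add: y)
  qed auto
  show ?thesis
  proof (rule that)
    show "abp_poly A = (\<Sum>x\<in>layer A m. (\<Sum>es\<in>P x. w es) * (\<Sum>es\<in>Q x. w es))"
      unfolding split
      by (subst sum.Sigma[symmetric])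
        (use fin fins in \<open>auto simp: sum_product sum.cartesian_product w_def\<close>)
    fix x assume x: "x \<in> layer A m"
    show "mvars (\<Sum>es\<in>P x. w es) \<subseteq> set (take m vs)"
    proof (rule mvars_sum)
      fix es assume "es \<in> P x"
      then show "mvars (w es) \<subseteq> set (take m vs)"
        using roabp_awalk(4)[OF assms(1) _ s, of es x] P_len[OF x] by (simp add: P_def w_def apath_def)
    qed
    show "mvars (\<Sum>es\<in>Q x. w es) \<subseteq> set (drop m vs)"
    proof (rule mvars_sum)
      fix es assume "es \<in> Q x"
      then show "mvars (w es) \<subseteq> set (drop m vs)"
        using roabp_awalk(4)[OF assms(1) _ x assms(2), of es "sink A"]
        by (auto simp: Q_def w_def apath_def dest: in_set_takeD)
    qed
  qed
qed

section \<open>Multiples of the product\<close>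

text \<open>A matching of \<open>U\<close> into the other variables picks out disjoint pairs, hence \<open>card U\<close> factors of \<open>f\<close> on
  disjoint sets of variables; the remaining factors are absorbed in the arbitrary multiplier \<open>g\<close>.\<close>

lemma triangular_multiple:
  fixes \<alpha> :: "nat \<Rightarrow> nat \<Rightarrow> 'a::field"
  assumes "f = (\<Prod>(i, j)\<in>{(i, j). 1 \<le> i \<and> i < j \<and> j \<le> n}. Var i + Var j + Const (\<alpha> i j))"
    and "g \<noteq> 0" "inj_on \<beta> U" "U \<subseteq> {1..n}" "\<beta> ` U \<subseteq> {1..n}" "\<beta> ` U \<inter> U = {}"
  obtains es where "length es = 2 ^ card U" "triangular U (\<beta> ` U) (g * f) es"
proof -
  define E where "E = {(i, j). 1 \<le> i \<and> i < j \<and> j \<le> n}"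
  define l where "l = (\<lambda>(i, j). Var i + Var j + Const (\<alpha> i j))"
  \<comment> \<open>The factors of \<open>f\<close> are indexed by increasing pairs, so
    \<open>u\<close> and its partner are sorted first.\<close>
  define e where "e u = (min u (\<beta> u), max u (\<beta> u))" for u
  have "E \<subseteq> {1..n} \<times> {1..n}" unfolding E_def by auto
  then have "finite E" by (rule finite_subset) simp
  have sub: "e ` U \<subseteq> E"
  proof
    fix x assume "x \<in> e ` U"
    then obtain u where u: "u \<in> U" "x = e u" by blast
    then have "u \<noteq> \<beta> u" "u \<in> {1..n}" "\<beta> u \<in> {1..n}" using assms(4-6) by blast+
    then show "x \<in> E" unfolding u(2) e_def E_def by (auto simp: min_def max_def)
  qed
  have inj: "inj_on e U"
  proof (rule inj_onI)
    fix x y assume "x \<in> U" "y \<in> U" "e x = e y"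
    \<comment> \<open>Equal sorted pairs have equal underlying sets; the second alternative fails
      because \<beta> maps out of \<open>U\<close>.\<close>
    then have "x = y \<or> x = \<beta> y"
      by (auto simp: e_def min_def max_def split: if_splits)
    then show "x = y" using assms(6) \<open>x \<in> U\<close> \<open>y \<in> U\<close> by blast
  qed
  have f: "f = (\<Prod>u\<in>U. l (e u)) * (\<Prod>x\<in>E - e ` U. l x)"
    using prod.subset_diff[OF sub \<open>finite E\<close>, of l] prod.reindex[OF inj, of l]
    unfolding assms(1) E_def[symmetric] l_def[symmetric] by (simp add: mult.commute o_def)
  have "l x \<noteq> 0" if "x \<in> E" for x
    using that by (auto simp: E_def l_def intro!: linear_form_neq_0)
  then have "(\<Prod>x\<in>E - e ` U. l x) \<noteq> 0"
    using \<open>finite E\<close> by simp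
  then have g': "g * (\<Prod>x\<in>E - e ` U. l x) \<noteq> 0" using assms(2) by simp
  have "finite U" using assms(4) finite_subset by blast
  moreover have "(\<Prod>u\<in>U. l (e u)) = (\<Prod>u\<in>U. Var u + Var (\<beta> u) + Const (\<alpha> (min u (\<beta> u)) (max u (\<beta> u))))"
    by (intro prod.cong) (auto simp: l_def e_def min_def max_def add.commute)
  ultimately obtain es where "length es = 2 ^ card U"
    "triangular U (\<beta> ` U) (g * (\<Prod>x\<in>E - e ` U. l x) * (\<Prod>u\<in>U. l (e u))) es"
    using triangular_list_exists[OF _ assms(3,6) g', of "\<lambda>u. \<alpha> (min u (\<beta> u)) (max u (\<beta> u))"]
    by auto
  moreover have "g * (\<Prod>x\<in>E - e ` U. l x) * (\<Prod>u\<in>U. l (e u)) = g * f"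
    unfolding f by (simp only: ac_simps)
  ultimately show ?thesis using that by simp
qed

theorem corollary6p22:
  fixes n :: nat
    and \<alpha> :: "nat \<Rightarrow> nat \<Rightarrow> 'a::field"
    and f g :: "'a mpoly"
  assumes f_def: "f = (\<Prod>(i, j)\<in>{(i, j). 1 \<le> i \<and> i < j \<and> j \<le> n}. Var i + Var j + Const (\<alpha> i j))"
    and g_vars: "mvars g \<subseteq> {1..n}"
    and g_nonzero: "g \<noteq> 0"
  shows "(\<forall>U V W m.
            U \<union> V \<union> W = {1..n} \<and> U \<inter> V = {} \<and> U \<inter> W = {} \<and> V \<inter> W = {} \<and>
            card U = m \<and> card V = m \<longrightarrow>
              2 ^ m \<le> poly_dim (ratfuns W) (Coeffs U V (over_ratfuns W (g * f))))
         \<and> (\<forall>vs r (A :: ('v, 'e, 'a) abp).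
              set vs = {1..n} \<and> is_roabp vs r A \<and> abp_poly A = g * f \<longrightarrow>
              2 ^ (n div 2) \<le> r)"
proof (intro conjI allI impI; elim conjE)
  fix U V W :: "nat set" and m
  assume UVW: "U \<union> V \<union> W = {1..n}" "U \<inter> V = {}" "U \<inter> W = {}" "V \<inter> W = {}"
    and card: "card U = m" "card V = m"
  have "finite U" "finite V" using UVW(1) finite_subset[of _ "{1..n}"] by auto
  then obtain \<beta> where \<beta>: "bij_betw \<beta> U V" using card finite_same_card_bij by metis
  then have img: "\<beta> ` U = V" and inj: "inj_on \<beta> U" by (auto simp: bij_betw_def)
  obtain es where es: "length es = 2 ^ card U" "triangular U V (g * f) es"
  proof (rule triangular_multiple[OF f_def g_nonzero inj, unfolded img])
    show "U \<subseteq> {1..n}" "V \<subseteq> {1..n}" using UVW(1) by blast+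
    show "V \<inter> U = {}" using UVW(2) by blast
  qed (rule that)
  have "mvars f \<subseteq> {1..n}"
    unfolding f_def
  proof (rule mvars_prod)
    fix x assume "x \<in> {(i, j). 1 \<le> i \<and> i < j \<and> j \<le> n}"
    then obtain i j where x: "x = (i, j)" "i \<in> {1..n}" "j \<in> {1..n}" by auto
    then show "mvars (case x of (i, j) \<Rightarrow> Var i + Var j + Const (\<alpha> i j)) \<subseteq> {1..n}"
      unfolding x(1) prod.case by (intro mvars_add) (auto simp: mvars_Var mvars_Const)
  qed
  with g_vars have "mvars (g * f) \<subseteq> U \<union> V \<union> W" unfolding UVW(1) by (rule mvars_mult)
  moreover have "(U \<union> V) \<inter> W = {}" using UVW(3,4) by blast
  ultimately have "length es \<le> poly_dim (ratfuns W) (Coeffs U V (over_ratfuns W (g * f)))"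
    by (rule poly_dim_Coeffs_ge[OF es(2)])
  then show "2 ^ m \<le> poly_dim (ratfuns W) (Coeffs U V (over_ratfuns W (g * f)))"
    unfolding es(1) card(1) .
next
  fix vs r and A :: "('v, 'e, 'a) abp"
  assume vs: "set vs = {1..n}" and A: "is_roabp vs r A" and h: "abp_poly A = g * f"
  define m where "m = n div 2"
  have "distinct vs" using A by (simp add: is_roabp_def)
  then have len: "length vs = n" using vs distinct_card by fastforce
  then have m: "m \<le> length vs" "m \<le> n - m" unfolding m_def by auto
  define U where "U = set (take m vs)"
  have disj: "set (drop m vs) \<inter> U = {}"
    using \<open>distinct vs\<close> set_take_disj_set_drop_if_distinct[of vs m m] unfolding U_def by blast
  have card: "card U = m" "card (set (drop m vs)) = n - m"
    unfolding U_def using \<open>distinct vs\<close> m len by (simp_all add: distinct_card)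
  have "finite U" unfolding U_def by simp
  \<comment> \<open>The variables read after the cut number \<open>n - m\<close>, which exceeds
    \<open>m\<close> for odd \<open>n\<close>; hence an injection rather than a bijection.\<close>
  then obtain \<beta> where \<beta>: "\<beta> ` U \<subseteq> set (drop m vs)" "inj_on \<beta> U"
    using card_le_inj[of U "set (drop m vs)"] card m(2) by auto
  have sub: "U \<subseteq> {1..n}" "set (drop m vs) \<subseteq> {1..n}"
    unfolding U_def vs[symmetric] by (rule set_take_subset set_drop_subset)+
  then have "\<beta> ` U \<subseteq> {1..n}" "\<beta> ` U \<inter> U = {}" using \<beta>(1) disj by blast+
  then obtain es where es: "length es = 2 ^ card U" "triangular U (\<beta> ` U) (g * f) es"
    by (rule triangular_multiple[OF f_def g_nonzero \<beta>(2) sub(1)])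
  obtain p q where pq: "abp_poly A = (\<Sum>x\<in>layer A m. p x * q x)"
    "\<And>x. x \<in> layer A m \<Longrightarrow> mvars (p x) \<subseteq> U"
    "\<And>x. x \<in> layer A m \<Longrightarrow> mvars (q x) \<subseteq> set (drop m vs)"
    by (rule roabp_factored[OF A m(1), folded U_def]) (rule that)
  interpret fin_digraph "graph A" using A by (simp add: is_roabp_def)
  have "layer A m \<subseteq> verts (graph A)" using A m(1) by (auto simp: is_roabp_def)
  then have fin: "finite (layer A m)" using finite_verts finite_subset by blast
  have "length es \<le> card (layer A m)"
  proof (rule length_le_card_if_factored[OF fin pq(1)[unfolded h] pq(2) _ es(2)])
    show "mvars (q x) \<inter> U = {}" if "x \<in> layer A m" for x using pq(3)[OF that] disj by blast
    show "U \<inter> \<beta> ` U = {}" using \<open>\<beta> ` U \<inter> U = {}\<close> by blast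
  qed
  also have "\<dots> \<le> r" using A m(1) by (simp add: is_roabp_def)
  finally show "2 ^ (n div 2) \<le> r" using es(1) card(1) m_def by simp
qed

end
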